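(* Let $n\ge 1$, and let $f,Q:\mathbb{R}^n\to\mathbb{R}$, $x_0,x_1,\tilde x_1,x_2,\tilde x_2\in\mathbb{R}^n$ and $\omega_1,\tilde\omega_1,\omega_2,\tilde\omega_2>0$ be as in the two-step trust-region setting described in the context. Assume that $f$ and $Q$ are nonconvex quadratic functions with diagonal Hessians $\nabla^2 f$ and $\nabla^2 Q$, that $\nabla^2 f+\omega_2\boldsymbol{I}\succ 0$ and $\nabla^2 Q+\tilde\omega_2\boldsymbol{I}\succ 0$, and that $\tilde x_1\neq x_1$. Let $\boldsymbol{\kappa}=\operatorname{diag}(\kappa^{[1]},\dots,\kappa^{[n]})\in\mathbb{R}^{n\times n}$ satisfy $$\boldsymbol{\kappa}(\tilde x_1-x_1)=x_1-x_0,$$ and let $0\le\rho\le1$. Write $\nabla^2 f^{[i]}$ and $\nabla^2 Q^{[i]}$ for the $i$-th diagonal elements of $\nabla^2 f$ and $\nabla^2 Q$, and set $$\kappa_1^{[i]}=\frac{(\nabla^2 f^{[i]}+\omega_2)\left[(-\rho+1)(\nabla^2 Q^{[i]}+\tilde\omega_2)+\tilde\omega_1\right]}{(\nabla^2 Q^{[i]}+\tilde\omega_2)\omega_1-(\nabla^2 f^{[i]}+\omega_2)\tilde\omega_1},\qquad \kappa_2^{[i]}=\frac{(\nabla^2 f^{[i]}+\omega_2)\left[(\rho+1)(\nabla^2 Q^{[i]}+\tilde\omega_2)+\tilde\omega_1\right]}{(\nabla^2 Q^{[i]}+\tilde\omega_2)\omega_1-(\nabla^2 f^{[i]}+\omega_2)\tilde\omega_1}.$$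 Suppose that for every $i\in\{1,\dots,n\}$ either $$(\nabla^2 Q^{[i]}+\tilde\omega_2)\,\omega_1>(\nabla^2 f^{[i]}+\omega_2)\,\tilde\omega_1\quad\text{and}\quad \kappa_1^{[i]}\le\kappa^{[i]}\le\kappa_2^{[i]},$$ or $$(\nabla^2 Q^{[i]}+\tilde\omega_2)\,\omega_1<(\nabla^2 f^{[i]}+\omega_2)\,\tilde\omega_1\quad\text{and}\quad \kappa_2^{[i]}\le\kappa^{[i]}\le\kappa_1^{[i]}.$$ Then $$\|\tilde x_2-x_2\|_2\le\rho\,\|\tilde x_1-x_1\|_2.$$
   Context: Two-step trust-region setting (in dimension $n$). $f,Q:\mathbb{R}^n\to\mathbb{R}$ are nonconvex quadratic functions (polynomials of degree two whose Hessians are not positive semidefinite); $\nabla^2 f$ and $\nabla^2 Q$ denote their constant Hessians. $\boldsymbol{I}$ is the identity matrix, and $\mathcal{B}(x,\Delta)=\{z\in\mathbb{R}^n:\|z-x\|_2\le\Delta\}$. The point $x_0\in\mathbb{R}^n$ is the initial point and $\Delta_1,\tilde\Delta_1,\Delta_2,\tilde\Delta_2>0$ are trust-region radii. The points $x_1$ and $\tilde x_1$ are minimizers of $f$ in $\mathcal{B}(x_0,\Delta_1)$ and of $Q$ in $\mathcal{B}(x_0,\tilde\Delta_1)$, respectively; $x_2$ and $\tilde x_2$ are minimizers of $f$ in $\mathcal{B}(x_1,\Delta_2)$ and of $Q$ in $\mathcal{B}(\tilde x_1,\tilde\Delta_2)$, respectively. Expressed through optimality conditions, this means that $\omega_1,\tilde\omega_1,\omega_2,\tilde\omega_2>0$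 are real numbers such that $$x_1-x_0=-(\nabla^2 f+\omega_1\boldsymbol{I})^{-1}\nabla f(x_0),\qquad \tilde x_1-x_0=-(\nabla^2 Q+\tilde\omega_1\boldsymbol{I})^{-1}\nabla Q(x_0),$$ $$x_2-x_1=-(\nabla^2 f+\omega_2\boldsymbol{I})^{-1}\nabla f(x_1),\qquad \tilde x_2-\tilde x_1=-(\nabla^2 Q+\tilde\omega_2\boldsymbol{I})^{-1}\nabla Q(\tilde x_1),$$ where $\Delta_1=\|x_1-x_0\|_2$, $\tilde\Delta_1=\|\tilde x_1-x_0\|_2$, $\Delta_2=\|x_2-x_1\|_2$, $\tilde\Delta_2=\|\tilde x_2-\tilde x_1\|_2$, and the four matrices $\nabla^2 f+\omega_1\boldsymbol{I}$, $\nabla^2 Q+\tilde\omega_1\boldsymbol{I}$, $\nabla^2 f+\omega_2\boldsymbol{I}$, $\nabla^2 Q+\tilde\omega_2\boldsymbol{I}$ are positive semidefinite (and invertible, as the formulas require). *)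

theory Defs
  imports "HOL-Analysis.Analysis"
begin

definition gradient :: "(real ^ 'n \<Rightarrow> real) \<Rightarrow> real ^ 'n \<Rightarrow> real ^ 'n"
  where "gradient f x = (THE g. GDERIV f x :> g)"

definition hessian :: "(real ^ 'n \<Rightarrow> real) \<Rightarrow> real ^ 'n \<Rightarrow> real ^ 'n ^ 'n"
  where "hessian f x = jacobian (gradient f) (at x)"

(* Taking the coefficient matrix A symmetric is no restriction (replace A by its
   symmetric part); A nonzero then says that the degree is exactly two. *)
definition quadratic_function :: "(real ^ 'n \<Rightarrow> real) \<Rightarrow> bool"
  where "quadratic_function f \<longleftrightarrow>
    (\<exists>A b c. transpose A = A \<and> A \<noteq> 0 \<and>
      (\<forall>x. f x = (1 / 2) * (x \<bullet> (A *v x)) + b \<bullet> x + c))"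

definition pos_semidef :: "real ^ 'n ^ 'n \<Rightarrow> bool"
  where "pos_semidef A \<longleftrightarrow> transpose A = A \<and> (\<forall>v. 0 \<le> v \<bullet> (A *v v))"

definition pos_def :: "real ^ 'n ^ 'n \<Rightarrow> bool"
  where "pos_def A \<longleftrightarrow> transpose A = A \<and> (\<forall>v. v \<noteq> 0 \<longrightarrow> 0 < v \<bullet> (A *v v))"

definition nonconvex_quadratic :: "(real ^ 'n \<Rightarrow> real) \<Rightarrow> bool"
  where "nonconvex_quadratic f \<longleftrightarrow>
    quadratic_function f \<and> (\<forall>x. \<not> pos_semidef (hessian f x))"

definition diagonal_matrix :: "real ^ 'n ^ 'n \<Rightarrow> bool"
  where "diagonal_matrix A \<longleftrightarrow> (\<forall>i j. i \<noteq> j \<longrightarrow> A $ i $ j = 0)"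

definition diag :: "real ^ 'n \<Rightarrow> real ^ 'n ^ 'n"
  where "diag d = (\<chi> i j. if i = j then d $ i else 0)"

(* x' minimizes f over the ball of radius D around x, together with its
   optimality conditions with multiplier w. *)
definition trust_region_step ::
    "(real ^ 'n \<Rightarrow> real) \<Rightarrow> real ^ 'n \<Rightarrow> real \<Rightarrow> real \<Rightarrow> real ^ 'n \<Rightarrow> bool"
  where "trust_region_step f x D w x' \<longleftrightarrow>
    D > 0 \<and> w > 0 \<and>
    is_arg_min f (\<lambda>z. z \<in> cball x D) x' \<and>
    D = norm (x' - x) \<and>
    pos_semidef (hessian f x + w *\<^sub>R mat 1) \<and>
    invertible (hessian f x + w *\<^sub>R mat 1) \<and>
    x' - x = - (matrix_inv (hessian f x + w *\<^sub>R mat 1) *v gradient f x)"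

end

theory Submission
  imports Defs
begin

text \<open>
  The optimality condition of a first step, combined with the affineness of the gradient, gives
  \<open>\<nabla>f(x\<^sub>1) = -\<omega>\<^sub>1 (x\<^sub>1 - x\<^sub>0)\<close>, so the second step solves
  \<open>(\<nabla>\<^sup>2f + \<omega>\<^sub>2 I)(x\<^sub>2 - x\<^sub>1) = \<omega>\<^sub>1 (x\<^sub>1 - x\<^sub>0)\<close>. With diagonal Hessians everything
  decouples into coordinates, where the new error is the old one multiplied by
  \<open>(a (b + \<omega>\<^sub>1') - \<kappa> (b \<omega>\<^sub>1 - a \<omega>\<^sub>1')) / (a b)\<close>, with \<open>\<omega>\<^sub>1'\<close> the multiplier of the first
  step for \<open>Q\<close> and \<open>a, b > 0\<close> the shifted diagonal Hessian entries of \<open>f\<close> and \<open>Q\<close>. The bounds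
  on \<open>\<kappa>\<close> say precisely that this factor lies in \<open>[-\<rho>, \<rho>]\<close>.
\<close>

text \<open>\<open>gradient\<close> is a definite description, so uniqueness is needed as well; it
  comes from uniqueness of the Frechet derivative, since a vector is determined by its inner
  products.\<close>

lemma gradient_eqI:
  assumes "GDERIV f x :> g"
  shows "gradient f x = g"
proof -
  have "h = g" if "GDERIV f x :> h" for h
  proof -
    have "(\<lambda>v. v \<bullet> h) = (\<lambda>v. v \<bullet> g)"
      using that assms unfolding gderiv_def by (rule has_derivative_unique)
    then show ?thesis
      by (metis vector_eq_ldot)
  qed
  with assms show ?thesis
    unfolding gradient_def by (rule the_equality)
qed

lemma gradient_quadratic:
  fixes A :: "real ^ 'n ^ 'n"
  assumes A: "transpose A = A"
  shows "gradient (\<lambda>x. (1 / 2) * (x \<bullet> (A *v x)) + b \<bullet> x + c) x = A *v x + b"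
proof (rule gradient_eqI)
  have "((\<lambda>x. A *v x) has_derivative (\<lambda>x. A *v x)) (at x)"
    by (rule bounded_linear_imp_has_derivative[OF matrix_vector_mul_bounded_linear])
  then have "((\<lambda>x. (1 / 2) * (x \<bullet> (A *v x)) + b \<bullet> x + c) has_derivative
      (\<lambda>h. (1 / 2) * (x \<bullet> (A *v h) + h \<bullet> (A *v x)) + b \<bullet> h)) (at x)"
    by (auto intro!: derivative_eq_intros)
  \<comment> \<open>Symmetry of \<open>A\<close> makes the two product-rule terms equal, which
    absorbs the factor 1/2.\<close>
  moreover have "x \<bullet> (A *v h) = h \<bullet> (A *v x)" for h
    by (metis A dot_lmul_matrix inner_commute vector_transpose_matrix)
  ultimately show "GDERIV (\<lambda>x. (1 / 2) * (x \<bullet> (A *v x)) + b \<bullet> x + c) x :> A *v x + b"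
    by (simp add: gderiv_def inner_add_right inner_commute[of b])
qed

text \<open>The gradient is \<open>A *v x + b\<close> and its Jacobian is \<open>A\<close> at every
  point, so the first-order expansion of the gradient is exact.\<close>

lemma gradient_affine:
  fixes f :: "real ^ 'n \<Rightarrow> real"
  assumes "quadratic_function f"
  shows "gradient f y = gradient f x + hessian f x *v (y - x)"
proof -
  obtain A b c where A: "transpose A = A"
    and f: "f = (\<lambda>x. (1 / 2) * (x \<bullet> (A *v x)) + b \<bullet> x + c)"
    using assms unfolding quadratic_function_def by blast
  have grad: "gradient f = (\<lambda>x. A *v x + b)"
    unfolding f using gradient_quadratic[OF A] by blast
  have "((\<lambda>x. A *v x + b) has_derivative (\<lambda>x. A *v x)) (at x)"
    by (rule has_derivative_add_const,
        rule bounded_linear_imp_has_derivative[OF matrix_vector_mul_bounded_linear])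
  then have "hessian f x = A"
    unfolding hessian_def grad jacobian_def
    by (metis frechet_derivative_at matrix_of_matrix_vector_mul)
  then show ?thesis
    by (simp add: grad matrix_vector_mult_diff_distrib)
qed

lemma matrix_mul_matrix_inv:
  assumes "invertible A"
  shows "A ** matrix_inv A = mat 1"
proof -
  have "A ** matrix_inv A = mat 1 \<and> matrix_inv A ** A = mat 1"
    using assms unfolding invertible_def matrix_inv_def by (rule someI_ex)
  then show ?thesis ..
qed

text \<open>Multiplying the step formula by the shifted Hessian cancels the inverse. The resulting
  linear system can be read off coordinate by coordinate when the Hessian is diagonal.\<close>

lemma trust_region_step_gradient:
  fixes f :: "real ^ 'n \<Rightarrow> real"
  assumes "trust_region_step f x D w x'"
  shows "(hessian f x + w *\<^sub>R mat 1) *v (x' - x) = - gradient f x"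
proof -
  let ?M = "hessian f x + w *\<^sub>R mat 1"
  have "invertible ?M" and "x' - x = - (matrix_inv ?M *v gradient f x)"
    using assms unfolding trust_region_step_def by auto
  then have "?M *v (x' - x) = - ((?M ** matrix_inv ?M) *v gradient f x)"
    by (simp add: matrix_vector_mul_assoc linear_neg[OF matrix_vector_mul_linear])
  then show ?thesis
    using matrix_mul_matrix_inv[OF \<open>invertible ?M\<close>] by (simp only: matrix_vector_mul_lid)
qed

lemma two_trust_region_steps:
  fixes f :: "real ^ 'n \<Rightarrow> real"
  assumes "quadratic_function f"
    and "trust_region_step f x0 D1 w1 x1" and "trust_region_step f x1 D2 w2 x2"
  shows "(hessian f x1 + w2 *\<^sub>R mat 1) *v (x2 - x1) = w1 *\<^sub>R (x1 - x0)"
proof -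
  have "hessian f x0 *v (x1 - x0) + w1 *\<^sub>R (x1 - x0) = - gradient f x0"
    using trust_region_step_gradient[OF assms(2)]
    by (simp add: matrix_vector_mult_add_rdistrib scaleR_matrix_vector_assoc[symmetric])
  \<comment> \<open>Moving \<open>gradient f x0\<close> to the left turns the Hessian term into the
    exact expansion of the gradient at \<open>x1\<close>.\<close>
  then have "gradient f x1 = - (w1 *\<^sub>R (x1 - x0))"
    unfolding gradient_affine[OF assms(1), of x1 x0] by (simp add: eq_neg_iff_add_eq_0 add_ac)
  then show ?thesis
    using trust_region_step_gradient[OF assms(3)] by (simp only: minus_minus)
qed

lemma shifted_diagonal_matrix_vector_nth:
  fixes H :: "real ^ 'n ^ 'n"
  assumes "diagonal_matrix H"
  shows "((H + w *\<^sub>R mat 1) *v v) $ i = (H $ i $ i + w) * v $ i"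
proof -
  have "(H + w *\<^sub>R mat 1) $ i $ j * v $ j = (if j = i then (H $ i $ i + w) * v $ i else 0)" for j
    using assms by (auto simp: diagonal_matrix_def mat_def)
  then show ?thesis
    by (simp add: matrix_vector_mult_def)
qed

lemma pos_def_diagonal_entry:
  assumes "pos_def A"
  shows "0 < A $ i $ i"
proof -
  have "0 < axis i 1 \<bullet> (A *v axis i 1)"
    using assms unfolding pos_def_def by (simp add: axis_eq_0_iff)
  then show ?thesis
    by (simp add: matrix_vector_mult_basis inner_axis' column_def)
qed

lemma diag_mult_nth: "(diag d *v v) $ i = d $ i * v $ i"
proof -
  have "diag d $ i $ j * v $ j = (if j = i then d $ i * v $ i else 0)" for j
    by (simp add: diag_def)
  then show ?thesis
    by (simp add: matrix_vector_mult_def)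
qed

text \<open>The scalar core, for one coordinate: \<open>p\<close> and \<open>q\<close> are the
  first-step multipliers of f and Q, \<open>s\<close> and \<open>d\<close> the entries of
  \<open>x1 - x0\<close> and \<open>x1t - x1\<close>, and \<open>u\<close> and \<open>v\<close>
  those of the second steps. Then \<open>s + d\<close> belongs to \<open>x1t - x0\<close> and
  \<open>d + v - u\<close> to the new error \<open>x2t - x2\<close>.\<close>

lemma coordinate_contraction:
  fixes a b s d k p q u v \<rho> :: real
  assumes a: "0 < a" and b: "0 < b"
    and u: "a * u = p * s" and v: "b * v = q * (s + d)" and s: "k * d = s"
    and k: "(b * p > a * q \<and>
        a * ((- \<rho> + 1) * b + q) / (b * p - a * q) \<le> k \<and>
        k \<le> a * ((\<rho> + 1) * b + q) / (b * p - a * q)) \<or>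
      (b * p < a * q \<and>
        a * ((\<rho> + 1) * b + q) / (b * p - a * q) \<le> k \<and>
        k \<le> a * ((- \<rho> + 1) * b + q) / (b * p - a * q))"
  shows "\<bar>d + v - u\<bar> \<le> \<rho> * \<bar>d\<bar>"
proof -
  \<comment> \<open>\<open>m\<close> is the error factor cleared of its denominator
    \<open>a * b\<close>.\<close>
  define m where "m = a * (b + q) - k * (b * p - a * q)"
  \<comment> \<open>Both cases give the same bounds: in the second the denominator is negative,
    which reverses the inequalities, but there the two bounds on \<open>k\<close> are
    interchanged.\<close>
  have "a * ((- \<rho> + 1) * b + q) \<le> k * (b * p - a * q) \<and>
      k * (b * p - a * q) \<le> a * ((\<rho> + 1) * b + q)"
    using k by (auto simp: pos_divide_le_eq pos_le_divide_eq neg_divide_le_eq neg_le_divide_eq)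
  \<comment> \<open>The two bounds are \<open>a * (b + q)\<close> shifted by
    \<open>\<rho> * (a * b)\<close> down and up.\<close>
  then have "\<bar>m\<bar> \<le> \<rho> * (a * b)"
    unfolding m_def by (auto simp: abs_le_iff algebra_simps)
  moreover have "(a * b) * (d + v - u) = a * b * d + a * (b * v) - b * (a * u)"
    by (simp add: algebra_simps)
  then have "(a * b) * (d + v - u) = m * d"
    unfolding u v s[symmetric] m_def by (simp add: algebra_simps)
  then have "(a * b) * \<bar>d + v - u\<bar> = \<bar>m\<bar> * \<bar>d\<bar>"
    using a b by (metis abs_mult abs_of_pos mult_pos_pos)
  ultimately have "(a * b) * \<bar>d + v - u\<bar> \<le> (a * b) * (\<rho> * \<bar>d\<bar>)"
    using mult_right_mono[of "\<bar>m\<bar>" "\<rho> * (a * b)" "\<bar>d\<bar>"] by (simp add: mult_ac)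
  then show ?thesis
    using a b by (simp add: mult_le_cancel_left_pos)
qed

theorem theorem2p2:
  fixes f Q :: "real ^ 'n \<Rightarrow> real"
    and x0 x1 x1t x2 x2t :: "real ^ 'n"
    and \<Delta>1 \<Delta>1t \<Delta>2 \<Delta>2t \<omega>1 \<omega>1t \<omega>2 \<omega>2t \<rho> :: real
    and Hf HQ :: "real ^ 'n ^ 'n"
    and \<kappa> \<kappa>1 \<kappa>2 :: "real ^ 'n"
  assumes "nonconvex_quadratic f" and "nonconvex_quadratic Q"
    and Hf: "\<And>x. hessian f x = Hf" and HQ: "\<And>x. hessian Q x = HQ"
    and "diagonal_matrix Hf" and "diagonal_matrix HQ"
    and "trust_region_step f x0 \<Delta>1 \<omega>1 x1"
    and "trust_region_step Q x0 \<Delta>1t \<omega>1t x1t"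
    and "trust_region_step f x1 \<Delta>2 \<omega>2 x2"
    and "trust_region_step Q x1t \<Delta>2t \<omega>2t x2t"
    and "pos_def (Hf + \<omega>2 *\<^sub>R mat 1)" and "pos_def (HQ + \<omega>2t *\<^sub>R mat 1)"
    and "x1t \<noteq> x1"
    and "diag \<kappa> *v (x1t - x1) = x1 - x0"
    and "0 \<le> \<rho>" and "\<rho> \<le> 1"
    and \<kappa>1: "\<And>i. \<kappa>1 $ i =
      (Hf $ i $ i + \<omega>2) * ((- \<rho> + 1) * (HQ $ i $ i + \<omega>2t) + \<omega>1t) /
      ((HQ $ i $ i + \<omega>2t) * \<omega>1 - (Hf $ i $ i + \<omega>2) * \<omega>1t)"
    and \<kappa>2: "\<And>i. \<kappa>2 $ i =
      (Hf $ i $ i + \<omega>2) * ((\<rho> + 1) * (HQ $ i $ i + \<omega>2t) + \<omega>1t) /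
      ((HQ $ i $ i + \<omega>2t) * \<omega>1 - (Hf $ i $ i + \<omega>2) * \<omega>1t)"
    and "\<And>i.
      ((HQ $ i $ i + \<omega>2t) * \<omega>1 > (Hf $ i $ i + \<omega>2) * \<omega>1t \<and>
        \<kappa>1 $ i \<le> \<kappa> $ i \<and> \<kappa> $ i \<le> \<kappa>2 $ i) \<or>
      ((HQ $ i $ i + \<omega>2t) * \<omega>1 < (Hf $ i $ i + \<omega>2) * \<omega>1t \<and>
        \<kappa>2 $ i \<le> \<kappa> $ i \<and> \<kappa> $ i \<le> \<kappa>1 $ i)"
  shows "norm (x2t - x2) \<le> \<rho> * norm (x1t - x1)"
proof -
  have f: "quadratic_function f" and Q: "quadratic_function Q"
    using assms(1,2) unfolding nonconvex_quadratic_def by auto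
  \<comment> \<open>The same \<rho> serves every coordinate, so the Euclidean norm inherits the
    bound by monotonicity.\<close>
  have "\<bar>(x2t - x2) $ i\<bar> \<le> \<bar>(\<rho> *\<^sub>R (x1t - x1)) $ i\<bar>" for i
  proof -
    have "(Hf $ i $ i + \<omega>2) * (x2 - x1) $ i = \<omega>1 * (x1 - x0) $ i"
      using two_trust_region_steps[OF f assms(7,9)]
        shifted_diagonal_matrix_vector_nth[OF assms(5), of \<omega>2 "x2 - x1" i]
      by (simp add: Hf)
    \<comment> \<open>Both first steps start at \<open>x0\<close>, so \<open>x1t - x0\<close> splits
      into \<open>x1 - x0\<close> plus the first error \<open>x1t - x1\<close>.\<close>
    moreover have "(HQ $ i $ i + \<omega>2t) * (x2t - x1t) $ i =
        \<omega>1t * ((x1 - x0) $ i + (x1t - x1) $ i)"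
      using two_trust_region_steps[OF Q assms(8,10)]
        shifted_diagonal_matrix_vector_nth[OF assms(6), of \<omega>2t "x2t - x1t" i]
      by (simp add: HQ)
    moreover have "\<kappa> $ i * (x1t - x1) $ i = (x1 - x0) $ i"
      using assms(14) by (metis diag_mult_nth)
    moreover have "0 < Hf $ i $ i + \<omega>2" "0 < HQ $ i $ i + \<omega>2t"
      using pos_def_diagonal_entry[OF assms(11), of i] pos_def_diagonal_entry[OF assms(12), of i]
      by (simp_all add: mat_def)
    \<comment> \<open>The left-hand sum telescopes to the coordinate of
      \<open>x2t - x2\<close>.\<close>
    ultimately have "\<bar>(x1t - x1) $ i + (x2t - x1t) $ i - (x2 - x1) $ i\<bar> \<le> \<rho> * \<bar>(x1t - x1) $ i\<bar>"
      using assms(19)[of i, unfolded \<kappa>1 \<kappa>2] by (intro coordinate_contraction) auto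
    then show ?thesis
      using \<open>0 \<le> \<rho>\<close> by (simp add: abs_mult)
  qed
  then have "norm (x2t - x2) \<le> norm (\<rho> *\<^sub>R (x1t - x1))"
    by (intro norm_le_componentwise_cart) simp
  then show ?thesis
    using \<open>0 \<le> \<rho>\<close> by simp
qed

end
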